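(* Assume $n\ge7$, (Y$^+_\partial$) and (BG$^{4+}$), and that $g$ is in the boundary-minimal gauge, $H_g\equiv0$ on $\partial M$. For $x$ in a Fermi collar (a boundary point) and $\varepsilon>0$ sufficiently small let $$A_k(x;\varepsilon)=\frac{E(x,k\varepsilon)}{k\varepsilon}\quad(k=1,2,3),\qquad \Delta_1=A_2-A_1,\quad\Delta_2=A_3-A_2 ,$$ $$\widehat\Theta_\varepsilon(x)=\frac{\Delta_2-\Delta_1}{2S_\ast\varepsilon^2},\qquad \widehat{\mathfrak R}_\varepsilon(x)=\frac{\Delta_1}{S_\ast\varepsilon}-3\varepsilon\,\widehat\Theta_\varepsilon(x).$$ Then $$\big|\widehat{\mathfrak R}_\varepsilon(x)-\mathfrak R_g^{\mathrm{bare}}(x)\big|\le C\varepsilon^2,\qquad \big|\widehat\Theta_\varepsilon(x)-\Theta_g(x)\big|\le C\varepsilon,$$ with $C=C(M,g,n)$ independent of $x$ in the collar.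
   Context: $(M^n,g)$ is a smooth compact Riemannian manifold with smooth boundary, $\nu$ the inward unit normal, $\bar g=g|_{T\partial M}$, $\mathrm{II}(X,Y)=-\langle\nabla_X\nu,Y\rangle_g$, $H_g=\frac1{n-1}\mathrm{tr}_{\bar g}\mathrm{II}$, $q=\frac{2(n-1)}{n-2}$, $$\langle u,u\rangle_{E,g}=\int_M\Big(|\nabla u|_g^2+\tfrac{n-2}{4(n-1)}\mathrm{Scal}_gu^2\Big)dV_g+\tfrac{n-2}2\int_{\partial M}H_gu^2d\sigma_g,\qquad \mathcal J_g[u]=\frac{\langle u,u\rangle_{E,g}}{\|u\|^2_{L^q(\partial M)}},$$ $S_\ast=\inf\mathcal J$ on the round hemisphere $S^n_+$. (Y$^+_\partial$): $\langle u,u\rangle_{E,g}\ge c_Y\|u\|_{H^1(M)}^2$ with $c_Y>0$. (BG$^{4+}$): there are $r_0>0$ and constants such that the interior injectivity radius is $\ge r_0$, the normal exponential map is a diffeomorphism on a collar of width $r_0$, $|\nabla^j\mathrm{Rm}_g|$ is bounded for $j\le2$ and $|\nabla_\top^j\mathrm{II}|$ is bounded for $j\le3$. Bubbles: $U_+(y)=A_n(|y'|^2+(1+y_n)^2)^{-\frac{n-2}2}$ on $\mathbb R^n_+$, $\|\nabla U_+\|_{L^2}=1$; $\chi_R(y)=\chi(y/R)$ with $\chi$ a fixed smooth radial cutoff equal to $1$ on $B_1$ and supported in $B_2$; $\Phi_x$ the boundary Fermi chart at $x\in\partial M$; $(\mathcal T_{x,\varepsilon}w)(z)=\varepsilon^{-\frac{n-2}2}w(\Phi_x^{-1}(z)/\varepsilon)$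 in the chart, $0$ outside. Coefficients: for fixed $R$, $\mathcal J_g[\mathcal T_{x,\varepsilon}(\chi_RU_+)]=S_\ast(R)(1+c_1(x,R)\varepsilon+c_2(x,R)\varepsilon^2+c_3(x,R)\varepsilon^3+o(\varepsilon^3))$ as $\varepsilon\downarrow0$, with $S_\ast(R)=\|\nabla(\chi_RU_+)\|_{L^2(\mathbb R^n_+)}^2/\|\chi_RU_+(\cdot,0)\|_{L^q(\mathbb R^{n-1})}^2$; $\mathfrak R_g^{\mathrm{bare}}(x)=\lim_{R\to\infty}c_2(x,R)$ and $\Theta_g(x)=\lim_{R\to\infty}c_3(x,R)$. Energies: $E(x,\varepsilon)=\mathcal J_g[v_{x,\varepsilon}]-S_\ast$, where $v_{x,\varepsilon}$ is the cutoff-independent boundary bubble "$\mathcal T_{x,\varepsilon}U_+$", understood through an admissible diagonal: $v_{x,\varepsilon}=\mathcal T_{x,\varepsilon}(\chi_{R(\varepsilon)}U_+)$ with $R(\varepsilon)\to\infty$, $\varepsilon R(\varepsilon)\to0$, chosen (the same for the scales $\varepsilon,2\varepsilon,3\varepsilon$) so that all cutoff-truncation errors are absorbed into the fourth-order remainder, i.e. the renormalized third-order expansion $E(x,\varepsilon)=S_\ast(\mathfrak R_g^{\mathrm{bare}}(x)\varepsilon^2+\Theta_g(x)\varepsilon^3)+O(\varepsilon^4)$ holds uniformly on compact collars. *)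

theory Defs
  imports "HOL-Analysis.Analysis" "HOL-Library.Landau_Symbols"
begin

text \<open>
  Conventions.  Coordinates of the \<open>n\<close>-dimensional manifold live in \<open>'e \<times> real\<close>, written
  \<open>y = (y', y_n)\<close>, with model half-space \<open>y_n \<ge> 0\<close>; so \<open>'e\<close> is the \<open>(n-1)\<close>-dimensional boundary
  model and \<open>n = DIM('e \<times> real)\<close>.  All derivatives of functions on a relatively open subset \<open>S\<close> of
  a half-space are taken \<open>at y within S\<close>; there they are unique, and they are the one-sided ones
  at boundary points.
\<close>


section \<open>Smoothness\<close>

primrec Ck_on :: "nat \<Rightarrow> 'v::real_normed_vector set \<Rightarrow> ('v \<Rightarrow> 'w::real_normed_vector) \<Rightarrow> bool" where
  "Ck_on 0 S f \<longleftrightarrow> continuous_on S f"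
| "Ck_on (Suc k) S f \<longleftrightarrow>
     f differentiable_on S \<and> (\<forall>v. Ck_on k S (\<lambda>x. frechet_derivative f (at x within S) v))"

definition smooth_on :: "'v::real_normed_vector set \<Rightarrow> ('v \<Rightarrow> 'w::real_normed_vector) \<Rightarrow> bool" where
  "smooth_on S f \<longleftrightarrow> (\<forall>k. Ck_on k S f)"


section \<open>Manifolds given by an indexed atlas\<close>

text \<open>
  A Riemannian structure on the point set \<open>pts\<close>: charts \<open>coord i\<close> with domain \<open>chart_dom i\<close>, and
  the local expression \<open>metric i y X Y\<close> of the metric tensor at the coordinate point \<open>y\<close>.
  A tangent vector is represented by its coordinates in a chart.
\<close>

record ('a, 'i, 'v) riem =
  pts :: "'a set"
  idx :: "'i set"
  chart_dom :: "'i \<Rightarrow> 'a set"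
  coord :: "'i \<Rightarrow> 'a \<Rightarrow> 'v"
  metric :: "'i \<Rightarrow> 'v \<Rightarrow> 'v \<Rightarrow> 'v \<Rightarrow> real"

definition chart_img :: "('a, 'i, 'v) riem \<Rightarrow> 'i \<Rightarrow> 'v set" where
  "chart_img A i = coord A i ` chart_dom A i"

definition chart_inv :: "('a, 'i, 'v) riem \<Rightarrow> 'i \<Rightarrow> 'v \<Rightarrow> 'a" where
  "chart_inv A i = inv_into (chart_dom A i) (coord A i)"

text \<open>Pointwise quantities independent of the chart are evaluated in a chosen chart at the point.\<close>

definition chart_at :: "('a, 'i, 'v) riem \<Rightarrow> 'a \<Rightarrow> 'i" where
  "chart_at A p = (SOME i. i \<in> idx A \<and> p \<in> chart_dom A i)"

definition coord_at :: "('a, 'i, 'v) riem \<Rightarrow> 'a \<Rightarrow> 'v" where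
  "coord_at A p = coord A (chart_at A p) p"

definition half_space :: "('e::euclidean_space \<times> real) set" where
  "half_space = {y. 0 \<le> snd y}"

definition compact_riem_mfd :: "('a::t2_space, 'i, 'e::euclidean_space \<times> real) riem \<Rightarrow> bool" where
  "compact_riem_mfd A \<longleftrightarrow>
     compact (pts A) \<and> pts A = (\<Union>i\<in>idx A. chart_dom A i) \<and>
     (\<forall>i\<in>idx A.
        openin (top_of_set (pts A)) (chart_dom A i) \<and>
        openin (top_of_set half_space) (chart_img A i) \<and>
        homeomorphism (chart_dom A i) (chart_img A i) (coord A i) (chart_inv A i)) \<and>
     (\<forall>i\<in>idx A. \<forall>j\<in>idx A.
        smooth_on (coord A i ` (chart_dom A i \<inter> chart_dom A j)) (coord A j \<circ> chart_inv A i)) \<and>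
     (\<forall>i\<in>idx A. \<forall>y\<in>chart_img A i.
        bilinear (metric A i y) \<and> (\<forall>X Y. metric A i y X Y = metric A i y Y X) \<and>
        (\<forall>X. X \<noteq> 0 \<longrightarrow> 0 < metric A i y X X)) \<and>
     (\<forall>i\<in>idx A. \<forall>X Y. smooth_on (chart_img A i) (\<lambda>y. metric A i y X Y)) \<and>
     (\<forall>i\<in>idx A. \<forall>j\<in>idx A. \<forall>y\<in>coord A i ` (chart_dom A i \<inter> chart_dom A j). \<forall>X Y.
        (let D = frechet_derivative (coord A j \<circ> chart_inv A i)
                   (at y within coord A i ` (chart_dom A i \<inter> chart_dom A j))
         in metric A i y X Y = metric A j (coord A j (chart_inv A i y)) (D X) (D Y)))"

definition bdry :: "('a, 'i, 'e::euclidean_space \<times> real) riem \<Rightarrow> 'a set" where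
  "bdry A = {p \<in> pts A. \<not> (\<exists>i\<in>idx A. p \<in> chart_dom A i \<and> 0 < snd (coord A i p))}"

text \<open>The boundary with the induced charts and the induced metric.\<close>

definition boundary :: "('a, 'i, 'e::euclidean_space \<times> real) riem \<Rightarrow> ('a, 'i, 'e) riem" where
  "boundary A = \<lparr> pts = bdry A, idx = idx A,
     chart_dom = (\<lambda>i. chart_dom A i \<inter> bdry A),
     coord = (\<lambda>i p. fst (coord A i p)),
     metric = (\<lambda>i y X Y. metric A i (y, 0) (X, 0) (Y, 0)) \<rparr>"

definition smooth_fun :: "('a, 'i, 'v::euclidean_space) riem \<Rightarrow> ('a \<Rightarrow> real) \<Rightarrow> bool" where
  "smooth_fun A u \<longleftrightarrow> (\<forall>i\<in>idx A. smooth_on (chart_img A i) (u \<circ> chart_inv A i))"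

text \<open>
  \<open>f\<close> maps the subset \<open>S\<close> of a vector space diffeomorphically onto a relatively open subset of the
  manifold.
\<close>

definition diffeo_onto_image ::
    "('a::topological_space, 'i, 'v::euclidean_space) riem \<Rightarrow> ('v \<Rightarrow> 'a) \<Rightarrow> 'v set \<Rightarrow> bool" where
  "diffeo_onto_image A f S \<longleftrightarrow>
     inj_on f S \<and> continuous_on S f \<and> f ` S \<subseteq> pts A \<and> openin (top_of_set (pts A)) (f ` S) \<and>
     (\<forall>j\<in>idx A.
        smooth_on {v \<in> S. f v \<in> chart_dom A j} (coord A j \<circ> f) \<and>
        smooth_on (coord A j ` (chart_dom A j \<inter> f ` S)) (inv_into S f \<circ> chart_inv A j))"


section \<open>Riemannian geometry in charts\<close>

text \<open>Directional derivative, in the chart \<open>i\<close>, of a function of the coordinates.\<close>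

definition dd :: "('a, 'i, 'v::euclidean_space) riem \<Rightarrow> 'i \<Rightarrow> ('v \<Rightarrow> 'w::real_normed_vector) \<Rightarrow> 'v \<Rightarrow> 'v \<Rightarrow> 'w" where
  "dd A i f y X = frechet_derivative f (at y within chart_img A i) X"

text \<open>Koszul formula for coordinate (constant) vector fields: \<open>christoffel A i y X Y\<close> is \<open>\<nabla>_X Y\<close>.\<close>

definition christoffel :: "('a, 'i, 'v::euclidean_space) riem \<Rightarrow> 'i \<Rightarrow> 'v \<Rightarrow> 'v \<Rightarrow> 'v \<Rightarrow> 'v" where
  "christoffel A i y X Y = (THE Z. \<forall>W. 2 * metric A i y Z W =
       dd A i (\<lambda>z. metric A i z Y W) y X + dd A i (\<lambda>z. metric A i z X W) y Y
     - dd A i (\<lambda>z. metric A i z X Y) y W)"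

text \<open>A linear frame, indexed by the standard basis, that is orthonormal for the inner product \<open>G\<close>.\<close>

definition onframe :: "('v::euclidean_space \<Rightarrow> 'v \<Rightarrow> real) \<Rightarrow> 'v \<Rightarrow> 'v" where
  "onframe G = (SOME f. \<forall>a\<in>Basis. \<forall>b\<in>Basis. G (f a) (f b) = (if a = b then 1 else 0))"

definition gram_det :: "('v::euclidean_space \<Rightarrow> 'v \<Rightarrow> real) \<Rightarrow> real" where
  "gram_det G = (\<Sum>p\<in>{p. p permutes Basis}. of_int (sign p) * (\<Prod>b\<in>Basis. G b (p b)))"

text \<open>The Riemannian measure: the unique Borel measure with density \<open>sqrt (det g)\<close> in every chart.\<close>

definition vol :: "('a::topological_space, 'i, 'v::euclidean_space) riem \<Rightarrow> 'a measure" where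
  "vol A = (THE \<mu>. space \<mu> = pts A \<and> sets \<mu> = sets (restrict_space borel (pts A)) \<and>
     (\<forall>i\<in>idx A. \<forall>B\<in>sets \<mu>. B \<subseteq> chart_dom A i \<longrightarrow>
        emeasure \<mu> B = (\<integral>\<^sup>+ y \<in> coord A i ` B. ennreal (sqrt (gram_det (metric A i y))) \<partial>lborel)))"

definition grad_sq :: "('a, 'i, 'v::euclidean_space) riem \<Rightarrow> ('a \<Rightarrow> real) \<Rightarrow> 'a \<Rightarrow> real" where
  "grad_sq A u p = (let i = chart_at A p; y = coord_at A p; f = onframe (metric A i y)
     in \<Sum>b\<in>Basis. (dd A i (u \<circ> chart_inv A i) y (f b))\<^sup>2)"

text \<open>
  Sign convention: \<open>R(X,Y)Z = \<nabla>_X \<nabla>_Y Z - \<nabla>_Y \<nabla>_X Z - \<nabla>_[X,Y] Z\<close> and \<open>Rm(X,Y,Z,W) = <R(X,Y)Z, W>\<close>,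
  so that the scalar curvature of the round unit sphere is \<open>n (n - 1)\<close>.
\<close>

definition riem_op :: "('a, 'i, 'v::euclidean_space) riem \<Rightarrow> 'i \<Rightarrow> 'v \<Rightarrow> 'v \<Rightarrow> 'v \<Rightarrow> 'v \<Rightarrow> 'v" where
  "riem_op A i y X Y Z =
     dd A i (\<lambda>z. christoffel A i z Y Z) y X - dd A i (\<lambda>z. christoffel A i z X Z) y Y
     + christoffel A i y X (christoffel A i y Y Z) - christoffel A i y Y (christoffel A i y X Z)"

definition scal :: "('a, 'i, 'v::euclidean_space) riem \<Rightarrow> 'a \<Rightarrow> real" where
  "scal A p = (let i = chart_at A p; y = coord_at A p; f = onframe (metric A i y)
     in \<Sum>a\<in>Basis. \<Sum>b\<in>Basis. metric A i y (riem_op A i y (f a) (f b) (f b)) (f a))"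

text \<open>
  A covariant \<open>k\<close>-tensor is a function of the chart, the coordinate point and a list of \<open>k\<close>
  vectors; covariant differentiation adds a new first slot.
\<close>

type_synonym ('i, 'v) tensor = "'i \<Rightarrow> 'v \<Rightarrow> 'v list \<Rightarrow> real"

definition cov_deriv :: "('a, 'i, 'v::euclidean_space) riem \<Rightarrow> ('i, 'v) tensor \<Rightarrow> ('i, 'v) tensor" where
  "cov_deriv A T i y Xs = dd A i (\<lambda>z. T i z (tl Xs)) y (hd Xs)
     - (\<Sum>k<length (tl Xs). T i y ((tl Xs)[k := christoffel A i y (hd Xs) (tl Xs ! k)]))"

definition tensor_norm :: "('a, 'i, 'v::euclidean_space) riem \<Rightarrow> nat \<Rightarrow> ('i, 'v) tensor \<Rightarrow> 'a \<Rightarrow> real" where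
  "tensor_norm A k T p = (let i = chart_at A p; y = coord_at A p; f = onframe (metric A i y)
     in sqrt (\<Sum>bs\<in>{bs. set bs \<subseteq> Basis \<and> length bs = k}. (T i y (map f bs))\<^sup>2))"

definition Rm :: "('a, 'i, 'v::euclidean_space) riem \<Rightarrow> ('i, 'v) tensor" where
  "Rm A i y Xs = metric A i y (riem_op A i y (Xs!0) (Xs!1) (Xs!2)) (Xs!3)"

text \<open>\<open>y\<close> is the coordinate of a boundary point in the boundary chart \<open>i\<close>.\<close>

definition inward_normal :: "('a, 'i, 'e::euclidean_space \<times> real) riem \<Rightarrow> 'i \<Rightarrow> 'e \<Rightarrow> 'e \<times> real" where
  "inward_normal A i y = (THE N. (\<forall>X. metric A i (y, 0) N (X, 0) = 0) \<and>
     metric A i (y, 0) N N = 1 \<and> 0 < snd N)"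

definition second_ff :: "('a, 'i, 'e::euclidean_space \<times> real) riem \<Rightarrow> ('i, 'e) tensor" where
  "second_ff A i y Xs =
     - metric A i (y, 0)
         (dd (boundary A) i (inward_normal A i) y (Xs!0)
          + christoffel A i (y, 0) (Xs!0, 0) (inward_normal A i y)) (Xs!1, 0)"

definition mean_curv :: "('a, 'i, 'e::euclidean_space \<times> real) riem \<Rightarrow> 'a \<Rightarrow> real" where
  "mean_curv A p = (let B = boundary A; i = chart_at B p; y = coord_at B p; f = onframe (metric B i y)
     in (\<Sum>b\<in>Basis. second_ff A i y [f b, f b]) / real DIM('e))"


section \<open>Exponential maps, Fermi charts and bounded geometry\<close>

definition geodesic :: "('a::topological_space, 'i, 'v::euclidean_space) riem \<Rightarrow> (real \<Rightarrow> 'a) \<Rightarrow> real set \<Rightarrow> bool" where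
  "geodesic A \<gamma> T \<longleftrightarrow> continuous_on T \<gamma> \<and> \<gamma> ` T \<subseteq> pts A \<and>
     (\<forall>i\<in>idx A. \<exists>c'. \<forall>t\<in>T. \<gamma> t \<in> chart_dom A i \<longrightarrow>
        ((coord A i \<circ> \<gamma>) has_vector_derivative c' t) (at t within T) \<and>
        (c' has_vector_derivative - christoffel A i (coord A i (\<gamma> t)) (c' t) (c' t)) (at t within T))"

text \<open>
  \<open>geo_exp A p v\<close> is the exponential map at \<open>p\<close> applied to the tangent vector with coordinates \<open>v\<close>
  in the chart \<open>chart_at A p\<close>; it is arbitrary (one fixed point) where the geodesic does not exist
  up to time 1.
\<close>

definition geo_exp :: "('a::topological_space, 'i, 'v::euclidean_space) riem \<Rightarrow> 'a \<Rightarrow> 'v \<Rightarrow> 'a" where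
  "geo_exp A p v = (THE q. \<exists>\<gamma>. geodesic A \<gamma> {0..1} \<and> \<gamma> 0 = p \<and> \<gamma> 1 = q \<and>
     ((coord A (chart_at A p) \<circ> \<gamma>) has_vector_derivative v) (at 0 within {0..1}))"

definition normal_exp :: "('a::topological_space, 'i, 'e::euclidean_space \<times> real) riem \<Rightarrow> 'a \<Rightarrow> real \<Rightarrow> 'a" where
  "normal_exp A p t =
     geo_exp A p (t *\<^sub>R inward_normal A (chart_at A p) (fst (coord_at A p)))"

text \<open>
  The boundary Fermi chart \<open>\<Phi>_x(y', t) = normal_exp (exp_x y') t\<close>, where \<open>exp_x\<close> is the exponential
  map of the boundary at \<open>x\<close> and \<open>y'\<close> is read in an orthonormal frame of the tangent space of the
  boundary.  Since bubble and cutoff are radial in \<open>y'\<close>, the choice of the frame is immaterial.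
\<close>

definition fermi :: "('a::topological_space, 'i, 'e::euclidean_space \<times> real) riem \<Rightarrow> 'a \<Rightarrow> 'e \<times> real \<Rightarrow> 'a" where
  "fermi A x y = (let B = boundary A; f = onframe (metric B (chart_at B x) (coord_at B x))
     in normal_exp A (geo_exp B x (\<Sum>b\<in>Basis. (fst y \<bullet> b) *\<^sub>R f b)) (snd y))"

definition fermi_dom :: "real \<Rightarrow> ('e::euclidean_space \<times> real) set" where
  "fermi_dom \<rho> = ball 0 \<rho> \<times> {0..<\<rho>}"

text \<open>\<open>\<rho>\<close> is a common radius for the Fermi charts at all boundary points.\<close>

definition fermi_radius :: "('a::topological_space, 'i, 'e::euclidean_space \<times> real) riem \<Rightarrow> real \<Rightarrow> bool" where
  "fermi_radius A \<rho> \<longleftrightarrow> 0 < \<rho> \<and> (\<forall>x\<in>bdry A. diffeo_onto_image A (fermi A x) (fermi_dom \<rho>))"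

definition collar :: "('a::topological_space, 'i, 'e::euclidean_space \<times> real) riem \<Rightarrow> real \<Rightarrow> 'a set" where
  "collar A r = (\<lambda>(p, t). normal_exp A p t) ` (bdry A \<times> {0..<r})"

text \<open>
  The interior injectivity radius is, as usual for manifolds with boundary of bounded geometry,
  measured at the points outside the collar.  The normal exponential map is a diffeomorphism from
  \<open>\<partial>M \<times> [0, r0)\<close>: injective, and a diffeomorphism onto an open set in each boundary chart.
\<close>

definition BG4plus :: "('a::topological_space, 'i, 'e::euclidean_space \<times> real) riem \<Rightarrow> bool" where
  "BG4plus A \<longleftrightarrow> (\<exists>r0>0.
     (\<forall>p\<in>pts A - collar A r0.
        diffeo_onto_image A (geo_exp A p)
          {v. sqrt (metric A (chart_at A p) (coord_at A p) v v) < r0}) \<and>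
     inj_on (\<lambda>(p, t). normal_exp A p t) (bdry A \<times> {0..<r0}) \<and>
     (\<forall>i\<in>idx A. diffeo_onto_image A
        (\<lambda>y. normal_exp A (chart_inv (boundary A) i (fst y)) (snd y))
        (chart_img (boundary A) i \<times> {0..<r0}))) \<and>
     (\<exists>C. \<forall>j\<le>2. \<forall>p\<in>pts A. tensor_norm A (4 + j) ((cov_deriv A ^^ j) (Rm A)) p \<le> C) \<and>
     (\<exists>C. \<forall>j\<le>3. \<forall>p\<in>bdry A.
        tensor_norm (boundary A) (2 + j) ((cov_deriv (boundary A) ^^ j) (second_ff A)) p \<le> C)"


section \<open>The Escobar functional\<close>

text \<open>The exponent \<open>q = 2 (n - 1) / (n - 2)\<close>.\<close>

definition q_exp :: "'e::euclidean_space itself \<Rightarrow> real" where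
  "q_exp _ = 2 * (real DIM('e \<times> real) - 1) / (real DIM('e \<times> real) - 2)"

definition energy :: "('a::topological_space, 'i, 'e::euclidean_space \<times> real) riem \<Rightarrow> ('a \<Rightarrow> real) \<Rightarrow> real" where
  "energy A u = (let n = real DIM('e \<times> real) in
     (LINT p|vol A. grad_sq A u p + (n - 2) / (4 * (n - 1)) * scal A p * (u p)\<^sup>2)
     + (n - 2) / 2 * (LINT p|vol (boundary A). mean_curv A p * (u p)\<^sup>2))"

definition H1_norm_sq :: "('a::topological_space, 'i, 'e::euclidean_space \<times> real) riem \<Rightarrow> ('a \<Rightarrow> real) \<Rightarrow> real" where
  "H1_norm_sq A u = (LINT p|vol A. grad_sq A u p + (u p)\<^sup>2)"

text \<open>Smooth functions are dense in \<open>H\<^sup>1(M)\<close>, and both sides are continuous there.\<close>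

definition yamabe_pos :: "('a::topological_space, 'i, 'e::euclidean_space \<times> real) riem \<Rightarrow> bool" where
  "yamabe_pos A \<longleftrightarrow> (\<exists>c>0. \<forall>u. smooth_fun A u \<longrightarrow> energy A u \<ge> c * H1_norm_sq A u)"

definition J_quot :: "('a::topological_space, 'i, 'e::euclidean_space \<times> real) riem \<Rightarrow> ('a \<Rightarrow> real) \<Rightarrow> real" where
  "J_quot A u = energy A u /
     (LINT p|vol (boundary A). \<bar>u p\<bar> powr q_exp TYPE('e)) powr (2 / q_exp TYPE('e))"

text \<open>
  The round closed hemisphere of dimension \<open>n\<close> in \<open>('e \<times> real) \<times> real\<close>, with the stereographic
  charts from the two boundary points \<open>(0, 1)\<close> and \<open>(0, -1)\<close>; they map onto the half-space, and
  the induced metric is \<open>4 (1 + |y|\<^sup>2)\<^sup>-\<^sup>2\<close> times the Euclidean one.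
\<close>

definition hemisphere :: "(('e::euclidean_space \<times> real) \<times> real, bool, 'e \<times> real) riem" where
  "hemisphere = (let M = {p. norm p = 1 \<and> 0 \<le> snd (fst p)};
                     s = (\<lambda>i. if i then 1 else - 1 :: real) in
     \<lparr> pts = M, idx = UNIV,
       chart_dom = (\<lambda>i. {p \<in> M. snd p \<noteq> s i}),
       coord = (\<lambda>i p. (1 / (1 - s i * snd p)) *\<^sub>R fst p),
       metric = (\<lambda>i y X Y. 4 / (1 + y \<bullet> y)\<^sup>2 * (X \<bullet> Y)) \<rparr>)"

text \<open>The infimum over smooth functions with nonzero trace (equivalently over \<open>H\<^sup>1\<close>, by density).\<close>

definition S_star :: "'e::euclidean_space itself \<Rightarrow> real" where
  "S_star _ = Inf (J_quot (hemisphere :: (('e \<times> real) \<times> real, bool, 'e \<times> real) riem) `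
     {u. smooth_fun (hemisphere :: (('e \<times> real) \<times> real, bool, 'e \<times> real) riem) u \<and>
         (\<exists>p\<in>bdry (hemisphere :: (('e \<times> real) \<times> real, bool, 'e \<times> real) riem). u p \<noteq> 0)})"


section \<open>Bubbles and their expansions\<close>

text \<open>\<open>\<parallel>\<nabla>w\<parallel>\<^sup>2\<close> in \<open>L\<^sup>2\<close> of the Euclidean half-space.\<close>

definition dirichlet :: "('e::euclidean_space \<times> real \<Rightarrow> real) \<Rightarrow> real" where
  "dirichlet w = (LINT y:half_space|lborel.
     (\<Sum>b\<in>Basis. (frechet_derivative w (at y within half_space) b)\<^sup>2))"

definition bubble0 :: "'e::euclidean_space \<times> real \<Rightarrow> real" where
  "bubble0 y = ((norm (fst y))\<^sup>2 + (1 + snd y)\<^sup>2) powr (- (real DIM('e \<times> real) - 2) / 2)"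

text \<open>The factor in front of \<open>bubble0\<close> is \<open>A_n\<close>, fixed by \<open>\<parallel>\<nabla>U_+\<parallel> = 1\<close>.\<close>

definition U_plus :: "'e::euclidean_space \<times> real \<Rightarrow> real" where
  "U_plus y = bubble0 y / sqrt (dirichlet (bubble0 :: 'e \<times> real \<Rightarrow> real))"

definition radial_cutoff :: "('e::euclidean_space \<times> real \<Rightarrow> real) \<Rightarrow> bool" where
  "radial_cutoff \<eta> \<longleftrightarrow> smooth_on UNIV \<eta> \<and> (\<forall>y z. norm y = norm z \<longrightarrow> \<eta> y = \<eta> z) \<and>
     (\<forall>y\<in>ball 0 1. \<eta> y = 1) \<and> closure {y. \<eta> y \<noteq> 0} \<subseteq> cball 0 2"

definition cut_bubble :: "('e::euclidean_space \<times> real \<Rightarrow> real) \<Rightarrow> real \<Rightarrow> 'e \<times> real \<Rightarrow> real" where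
  "cut_bubble \<eta> R y = \<eta> ((1 / R) *\<^sub>R y) * U_plus y"

text \<open>The operator \<open>T_{x,\<epsilon>}\<close>, in the Fermi chart of radius \<open>\<rho>\<close>.\<close>

definition transplant ::
    "('a::topological_space, 'i, 'e::euclidean_space \<times> real) riem \<Rightarrow> real \<Rightarrow> 'a \<Rightarrow> real \<Rightarrow>
     ('e \<times> real \<Rightarrow> real) \<Rightarrow> 'a \<Rightarrow> real" where
  "transplant A \<rho> x \<epsilon> w z =
     (if z \<in> fermi A x ` fermi_dom \<rho>
      then \<epsilon> powr (- (real DIM('e \<times> real) - 2) / 2) *
           w ((1 / \<epsilon>) *\<^sub>R inv_into (fermi_dom \<rho>) (fermi A x) z)
      else 0)"

definition S_trunc :: "('e::euclidean_space \<times> real \<Rightarrow> real) \<Rightarrow> real \<Rightarrow> real" where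
  "S_trunc \<eta> R = dirichlet (cut_bubble \<eta> R) /
     (LINT y|lborel. \<bar>cut_bubble \<eta> R (y, 0)\<bar> powr q_exp TYPE('e)) powr (2 / q_exp TYPE('e))"

text \<open>The coefficients \<open>(c_1(x,R), c_2(x,R), c_3(x,R))\<close>; they are unique when they exist.\<close>

definition bubble_coeffs ::
    "('a::topological_space, 'i, 'e::euclidean_space \<times> real) riem \<Rightarrow> real \<Rightarrow> ('e \<times> real \<Rightarrow> real) \<Rightarrow>
     'a \<Rightarrow> real \<Rightarrow> real \<times> real \<times> real" where
  "bubble_coeffs A \<rho> \<eta> x R = (THE c. case c of (c1, c2, c3) \<Rightarrow>
     (\<lambda>\<epsilon>. J_quot A (transplant A \<rho> x \<epsilon> (cut_bubble \<eta> R))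
          - S_trunc \<eta> R * (1 + c1 * \<epsilon> + c2 * \<epsilon>^2 + c3 * \<epsilon>^3))
       \<in> o[at_right 0](\<lambda>\<epsilon>. \<epsilon>^3))"

definition R_bare ::
    "('a::topological_space, 'i, 'e::euclidean_space \<times> real) riem \<Rightarrow> real \<Rightarrow> ('e \<times> real \<Rightarrow> real) \<Rightarrow> 'a \<Rightarrow> real" where
  "R_bare A \<rho> \<eta> x = Lim at_top (\<lambda>R. fst (snd (bubble_coeffs A \<rho> \<eta> x R)))"

definition Theta ::
    "('a::topological_space, 'i, 'e::euclidean_space \<times> real) riem \<Rightarrow> real \<Rightarrow> ('e \<times> real \<Rightarrow> real) \<Rightarrow> 'a \<Rightarrow> real" where
  "Theta A \<rho> \<eta> x = Lim at_top (\<lambda>R. snd (snd (bubble_coeffs A \<rho> \<eta> x R)))"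

text \<open>The energy \<open>E(x,\<epsilon>)\<close> along the diagonal \<open>Rd\<close>.\<close>

definition bubble_energy ::
    "('a::topological_space, 'i, 'e::euclidean_space \<times> real) riem \<Rightarrow> real \<Rightarrow> ('e \<times> real \<Rightarrow> real) \<Rightarrow>
     (real \<Rightarrow> real) \<Rightarrow> 'a \<Rightarrow> real \<Rightarrow> real" where
  "bubble_energy A \<rho> \<eta> Rd x \<epsilon> =
     J_quot A (transplant A \<rho> x \<epsilon> (cut_bubble \<eta> (Rd \<epsilon>))) - S_star TYPE('e)"

text \<open>
  The cutoff-truncation errors, in particular the one of the leading
  constant \<open>S_*(R)\<close>, are absorbed into the fourth-order remainder, and the renormalized expansion
  holds uniformly for base points in compact sets.
\<close>

definition admissible_diagonal ::
    "('a::topological_space, 'i, 'e::euclidean_space \<times> real) riem \<Rightarrow> real \<Rightarrow> ('e \<times> real \<Rightarrow> real) \<Rightarrow>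
     (real \<Rightarrow> real) \<Rightarrow> bool" where
  "admissible_diagonal A \<rho> \<eta> Rd \<longleftrightarrow>
     filterlim Rd at_top (at_right 0) \<and> ((\<lambda>\<epsilon>. \<epsilon> * Rd \<epsilon>) \<longlongrightarrow> 0) (at_right 0) \<and>
     (\<lambda>\<epsilon>. S_trunc \<eta> (Rd \<epsilon>) - S_star TYPE('e)) \<in> O[at_right 0](\<lambda>\<epsilon>. \<epsilon>^4) \<and>
     (\<forall>K. compact K \<and> K \<subseteq> bdry A \<longrightarrow>
        (\<exists>C. \<exists>\<epsilon>0>0. \<forall>x\<in>K. \<forall>\<epsilon>. 0 < \<epsilon> \<and> \<epsilon> < \<epsilon>0 \<longrightarrow>
           \<bar>bubble_energy A \<rho> \<eta> Rd x \<epsilon>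
             - S_star TYPE('e) * (R_bare A \<rho> \<eta> x * \<epsilon>^2 + Theta A \<rho> \<eta> x * \<epsilon>^3)\<bar> \<le> C * \<epsilon>^4))"


section \<open>Three-scale estimators\<close>

text \<open>Here \<open>E\<close> is the energy as a function of the scale and \<open>S\<close> stands for \<open>S_*\<close>.\<close>

definition quotA :: "(real \<Rightarrow> real) \<Rightarrow> real \<Rightarrow> real \<Rightarrow> real" where
  "quotA E \<epsilon> k = E (k * \<epsilon>) / (k * \<epsilon>)"

definition Delta1 :: "(real \<Rightarrow> real) \<Rightarrow> real \<Rightarrow> real" where
  "Delta1 E \<epsilon> = quotA E \<epsilon> 2 - quotA E \<epsilon> 1"

definition Delta2 :: "(real \<Rightarrow> real) \<Rightarrow> real \<Rightarrow> real" where
  "Delta2 E \<epsilon> = quotA E \<epsilon> 3 - quotA E \<epsilon> 2"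

definition Theta_hat :: "real \<Rightarrow> (real \<Rightarrow> real) \<Rightarrow> real \<Rightarrow> real" where
  "Theta_hat S E \<epsilon> = (Delta2 E \<epsilon> - Delta1 E \<epsilon>) / (2 * S * \<epsilon>^2)"

definition R_hat :: "real \<Rightarrow> (real \<Rightarrow> real) \<Rightarrow> real \<Rightarrow> real" where
  "R_hat S E \<epsilon> = Delta1 E \<epsilon> / (S * \<epsilon>) - 3 * \<epsilon> * Theta_hat S E \<epsilon>"

end

theory Submission
  imports Defs
begin

text \<open>
  With \<open>E(k\<epsilon>) = S\<^sub>*(a k\<^sup>2\<epsilon>\<^sup>2 + b k\<^sup>3\<epsilon>\<^sup>3) + O(\<epsilon>\<^sup>4)\<close>, the quotients \<open>A\<^sub>k\<close> are quadratic polynomials in \<open>k\<close>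
  up to \<open>O(\<epsilon>\<^sup>3)\<close>, so finite differences recover both coefficients; the expansion is uniform because
  \<open>\<partial>M\<close> is compact.  The division by \<open>S\<^sub>*\<close> requires \<open>S\<^sub>* \<noteq> 0\<close>.  This does not need the sharp trace
  inequality on the hemisphere: along an admissible diagonal \<open>S\<^sub>*(R) \<rightarrow> S\<^sub>*\<close>, and \<open>S\<^sub>*(R)\<close> is bounded
  below for \<open>R \<ge> 1\<close>, since the truncated bubbles agree on the unit half-ball and their traces are
  bounded in \<open>L\<^sup>q\<close>.
\<close>

section \<open>Integrability of power weights\<close>

text \<open>Dyadic decomposition: where 2^k \<le> 1 + |y| < 2^(k+1) the weight is at most 2^(-ak),
  and this shell lies in a ball of volume proportional to 2^(kd), with d the dimension. The integral
  is thus dominated by a geometric series of ratio 2^(d-a) < 1.\<close>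

lemma integrable_one_plus_norm_powr:
  fixes a :: real
  assumes "DIM('v) < a"
  shows "integrable lborel (\<lambda>y::'v::euclidean_space. (1 + norm y) powr - a)"
proof (rule integrableI_bounded)
  let ?d = "DIM('v)" and ?V = "unit_ball_vol (real DIM('v))"
  let ?B = "\<lambda>k. ball (0::'v) (2 ^ Suc k)"
  have shell: "ennreal (norm ((1 + norm y) powr - a))
      \<le> (\<Sum>k. ennreal ((2 powr - a) ^ k) * indicator (?B k) y)" for y :: 'v
  proof -
    define k where "k = nat \<lfloor>log 2 (1 + norm y)\<rfloor>"
    have "1 \<le> 1 + norm y" by simp
    then have "0 \<le> log 2 (1 + norm y)" by (subst zero_le_log_cancel_iff) (auto simp: add_pos_nonneg)
    then have k: "real k \<le> log 2 (1 + norm y)" "log 2 (1 + norm y) < real (Suc k)"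
      unfolding k_def by linarith+
    have pos: "0 < 1 + norm y" by (simp add: add_pos_nonneg)
    have lo: "2 powr real k \<le> 1 + norm y" and hi: "1 + norm y < 2 powr real (Suc k)"
      using k le_log_iff[of 2 "1 + norm y" "real k"] log_less_iff[of 2 "1 + norm y" "real (Suc k)"] pos
      by (simp_all del: of_nat_Suc)
    have "(1 + norm y) powr - a \<le> (2 powr real k) powr - a"
      using lo assms by (intro powr_mono2') auto
    also have "\<dots> = (2 powr - a) ^ k"
      by (subst powr_realpow[symmetric], simp) (simp only: powr_powr mult.commute)
    finally have "(1 + norm y) powr - a \<le> (2 powr - a) ^ k" .
    moreover have "y \<in> ?B k"
      using hi powr_realpow[of 2 "Suc k"] by (simp del: power_Suc of_nat_Suc)
    moreover define F where "F = (\<lambda>k. ennreal ((2 powr - a) ^ k) * indicator (?B k) y)"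
    \<comment> \<open>One term of the series suffices. Balls are used instead of shells, so later
      terms count \<open>y\<close> again, which is harmless for an upper bound.\<close>
    ultimately have "ennreal (norm ((1 + norm y) powr - a)) \<le> sum F {k}"
      by (simp add: F_def ennreal_leI del: power_Suc)
    also have "\<dots> \<le> suminf F" by (rule sum_le_suminf) auto
    also have "\<dots> = (\<Sum>k. ennreal ((2 powr - a) ^ k) * indicator (?B k) y)" by (simp only: F_def)
    finally show ?thesis .
  qed
  have "(\<integral>\<^sup>+ y. ennreal (norm ((1 + norm y) powr - a)) \<partial>(lborel :: 'v measure))
      \<le> (\<integral>\<^sup>+ y. (\<Sum>k. ennreal ((2 powr - a) ^ k) * indicator (?B k) y) \<partial>lborel)"
    by (intro nn_integral_mono shell)
  also have "\<dots> = (\<Sum>k. \<integral>\<^sup>+ y. ennreal ((2 powr - a) ^ k) * indicator (?B k) y \<partial>lborel)"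
    by (intro nn_integral_suminf borel_measurable_times_ennreal borel_measurable_const borel_measurable_indicator)
      (simp del: power_Suc)
  also have "\<dots> = (\<Sum>k. ennreal ((2 powr - a) ^ k) * emeasure lborel (?B k))"
    by (intro suminf_cong nn_integral_cmult_indicator) (simp del: power_Suc)
  \<comment> \<open>The extra factor \<open>2 ^ ?d\<close> appears because the k-th ball has radius
    2^(k+1) rather than 2^k.\<close>
  also have "\<dots> = (\<Sum>k. ennreal (?V * 2 ^ ?d * (2 powr (?d - a)) ^ k))"
  proof (intro suminf_cong)
    fix k
    have p: "(2::real) powr (?d - a) = 2 ^ ?d * 2 powr - a"
      using powr_add[of 2 "real ?d" "- a"] powr_realpow[of 2 ?d] by simp
    have "((2::real) ^ Suc k) ^ ?d = (2 ^ ?d) ^ Suc k"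
      by (metis power_mult mult.commute)
    then have eq: "(2 powr - a) ^ k * (2 ^ Suc k) ^ ?d = 2 ^ ?d * (2 powr (?d - a)) ^ k"
      by (simp only: p power_mult_distrib power_Suc mult_ac)
    have "ennreal ((2 powr - a) ^ k) * emeasure lborel (?B k) = ennreal ((2 powr - a) ^ k * (?V * (2 ^ Suc k) ^ ?d))"
      by (subst emeasure_ball) (simp_all add: ennreal_mult' del: power_Suc)
    also have "(2 powr - a) ^ k * (?V * (2 ^ Suc k) ^ ?d) = ?V * ((2 powr - a) ^ k * (2 ^ Suc k) ^ ?d)"
      by (rule mult.left_commute)
    also have "\<dots> = ?V * 2 ^ ?d * (2 powr (?d - a)) ^ k"
      by (simp only: eq mult.assoc)
    finally show "ennreal ((2 powr - a) ^ k) * emeasure lborel (?B k)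
        = ennreal (?V * 2 ^ ?d * (2 powr (?d - a)) ^ k)" .
  qed
  also have "\<dots> < \<infinity>"
  proof -
    have "2 powr (?d - a) < 1" using assms by (simp add: powr_less_one)
    then have "summable (\<lambda>k. ?V * 2 ^ ?d * (2 powr (?d - a)) ^ k)"
      by (intro summable_mult summable_geometric) simp
    then have "(\<Sum>k. ennreal (?V * 2 ^ ?d * (2 powr (?d - a)) ^ k)) \<noteq> top"
      by (rule ennreal_suminf_neq_top) simp
    then show ?thesis by (simp only: infinity_ennreal_def top.not_eq_extremum)
  qed
  finally show "(\<integral>\<^sup>+ y. ennreal (norm ((1 + norm y) powr - a)) \<partial>(lborel :: 'v measure)) < \<infinity>" .
qed measurable

section \<open>Gradients and integrals on the half-space\<close>

lemma has_derivative_norm_powr: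
  fixes z :: "'v::real_inner"
  assumes "z \<noteq> 0"
  shows "((\<lambda>x. norm x powr a) has_derivative (\<lambda>h. (a * norm z powr (a - 2)) *\<^sub>R z \<bullet> h)) (at z)"
proof -
  have "((\<lambda>x. norm x powr a) has_derivative
      (\<lambda>h. norm z powr a * (0 * ln (norm z) + (sgn z \<bullet> h) * a / norm z))) (at z)"
    using assms by (auto intro!: derivative_eq_intros has_derivative_norm simp: fun_eq_iff inner_commute)
  also have "(\<lambda>h. norm z powr a * (0 * ln (norm z) + (sgn z \<bullet> h) * a / norm z))
      = (\<lambda>h. (a * norm z powr (a - 2)) *\<^sub>R z \<bullet> h)"
    using assms by (simp add: fun_eq_iff sgn_div_norm powr_diff powr_realpow power2_eq_square field_simps)
  finally show ?thesis .
qed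

text \<open>Uniqueness needs arbitrarily short steps inside the set along every basis vector. The
  standard basis vectors have nonnegative last component, so forward steps never leave the
  half-space, even from its boundary.\<close>

lemma frechet_derivative_half_space:
  fixes f :: "'e::euclidean_space \<times> real \<Rightarrow> 'w::real_normed_vector"
  assumes "y \<in> half_space" "(f has_derivative f') (at y within half_space)"
  shows "frechet_derivative f (at y within half_space) = f'"
proof -
  have "(f has_derivative frechet_derivative f (at y within half_space)) (at y within half_space)"
    using assms(2) frechet_derivative_works differentiable_def by blast
  moreover have "\<exists>d. 0 < \<bar>d\<bar> \<and> \<bar>d\<bar> < e \<and> y + d *\<^sub>R i \<in> half_space"
    if "i \<in> Basis" "0 < e" for e and i :: "'e \<times> real"
  proof (intro exI conjI)
    have "0 \<le> snd i" using that by (auto simp: Basis_prod_def)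
    then show "y + (e / 2) *\<^sub>R i \<in> half_space" "0 < \<bar>e / 2\<bar>" "\<bar>e / 2\<bar> < e"
      using that assms(1) by (auto simp: half_space_def)
  qed
  ultimately show ?thesis
    using assms(2) frechet_derivative_unique_within by metis
qed

lemma closed_half_space: "closed (half_space :: ('e::euclidean_space \<times> real) set)"
  unfolding half_space_def by (intro closed_Collect_le continuous_intros)

lemma half_space_sets_borel [measurable]: "(half_space :: ('e::euclidean_space \<times> real) set) \<in> sets borel"
  by (intro borel_closed closed_half_space)

text \<open>Turns \<open>dirichlet\<close> into the integral of an explicit squared gradient; it is
  applied both to the bubble and to its truncations.\<close>

lemma dirichlet_gradient:
  fixes w :: "'e::euclidean_space \<times> real \<Rightarrow> real"
  assumes "\<And>y. y \<in> half_space \<Longrightarrow> (w has_derivative (\<lambda>h. g y \<bullet> h)) (at y within half_space)"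
  shows "dirichlet w = (LINT y:half_space|lborel. (norm (g y))\<^sup>2)"
  unfolding dirichlet_def
proof (intro set_lebesgue_integral_cong allI impI)
  fix y :: "'e \<times> real" assume y: "y \<in> half_space"
  have "(norm (g y))\<^sup>2 = (\<Sum>b\<in>Basis. (g y \<bullet> b)\<^sup>2)"
    unfolding power2_norm_eq_inner by (subst euclidean_inner) (simp add: power2_eq_square)
  then show "(\<Sum>b\<in>Basis. (frechet_derivative w (at y within half_space) b)\<^sup>2) = (norm (g y))\<^sup>2"
    using frechet_derivative_half_space[OF y assms[OF y]] by simp
qed simp

text \<open>A nonnegative integrable function with integral 0 vanishes almost everywhere, which
  would make \<open>U\<close> a null set; a nonempty open set is not one.\<close>

lemma integral_pos_open:
  fixes f :: "'v::euclidean_space \<Rightarrow> real"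
  assumes "integrable lborel f" "\<And>y. 0 \<le> f y" "open U" "U \<noteq> {}" "\<And>y. y \<in> U \<Longrightarrow> 0 < f y"
  shows "0 < integral\<^sup>L lborel f"
proof (rule ccontr)
  assume "\<not> ?thesis"
  moreover have "0 \<le> integral\<^sup>L lborel f"
    by (intro integral_nonneg_AE AE_I2 assms(2))
  ultimately have "integral\<^sup>L lborel f = 0" by linarith
  then have "AE y in lborel. f y = 0"
    using integral_nonneg_eq_0_iff_AE[OF assms(1)] assms(2) by simp
  then have "AE y in lborel. y \<notin> U"
    by eventually_elim (use assms(5) in force)
  then have "U \<in> null_sets lborel"
    using assms(3) by (subst AE_iff_null_sets) auto
  then have "negligible U"
    using null_sets_completionI negligible_iff_null_sets by blast
  then show False using open_not_negligible assms(3,4) by blast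
qed

section \<open>The bubble, its gradient and their decay\<close>

text \<open>The bubble has its pole at (0, -1). The first bound keeps the half-space away from the
  pole, the second converts decay in the distance to the pole into decay in |y|. Both follow from |y
  + (0,1)|^2 = 1 + 2 y_n + |y|^2 with y_n \<ge> 0.\<close>

lemma half_space_shift:
  fixes y :: "'e::euclidean_space \<times> real"
  assumes "y \<in> half_space"
  shows "1 \<le> norm (y + (0, 1))" "1 + norm y \<le> 2 * norm (y + (0, 1))"
proof -
  have sq: "(norm (y + (0, 1)))\<^sup>2 = 1 + 2 * snd y + (norm y)\<^sup>2"
    by (cases y, simp add: norm_Pair, simp add: power2_sum)
  have y: "0 \<le> snd y" using assms by (simp add: half_space_def)
  show one: "1 \<le> norm (y + (0, 1))"
    using y by (rule_tac power2_le_imp_le) (simp_all add: sq)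
  have "norm y \<le> norm (y + (0, 1))"
    using y by (rule_tac power2_le_imp_le) (simp_all add: sq)
  then show "1 + norm y \<le> 2 * norm (y + (0, 1))" using one by linarith
qed

lemma half_space_shift_powr_le:
  fixes y :: "'e::euclidean_space \<times> real"
  assumes "y \<in> half_space" "0 \<le> a"
  shows "norm (y + (0, 1)) powr - a \<le> 2 powr a * (1 + norm y) powr - a"
proof -
  have "norm (y + (0, 1)) powr - a \<le> ((1 + norm y) / 2) powr - a"
    using half_space_shift[OF assms(1)] assms(2) by (intro powr_mono2') (auto simp: add_pos_nonneg)
  also have "\<dots> = 2 powr a * (1 + norm y) powr - a"
    by (simp add: powr_divide powr_minus_divide)
  finally show ?thesis .
qed

text \<open>Exhibits the bubble as a power of the distance to its pole, so that
  \<open>has_derivative_norm_powr\<close> yields the gradient directly.\<close>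

lemma bubble0_eq:
  "bubble0 (y :: 'e::euclidean_space \<times> real) = norm (y + (0, 1)) powr (2 - real DIM('e \<times> real))"
proof -
  have "(norm (fst y))\<^sup>2 + (1 + snd y)\<^sup>2 = norm (y + (0, 1)) powr 2"
    by (cases y) (simp add: norm_Pair add.commute)
  moreover have "2 * (- (n - 2) / 2) = 2 - n" for n :: real by simp
  ultimately show ?thesis
    by (simp only: bubble0_def powr_powr)
qed

definition bubble_grad :: "'e::euclidean_space \<times> real \<Rightarrow> 'e \<times> real" where
  "bubble_grad y = ((2 - real DIM('e \<times> real)) * norm (y + (0, 1)) powr - real DIM('e \<times> real)) *\<^sub>R (y + (0, 1))"

lemma has_derivative_bubble0:
  fixes y :: "'e::euclidean_space \<times> real"
  assumes "y \<in> half_space"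
  shows "(bubble0 has_derivative (\<lambda>h. bubble_grad y \<bullet> h)) (at y within half_space)"
proof -
  let ?n = "real DIM('e \<times> real)"
  have "y + (0, 1) \<noteq> 0" using half_space_shift(1)[OF assms] by auto
  from has_derivative_norm_powr[OF this, of "2 - ?n"]
  have "((\<lambda>x. norm x powr (2 - ?n)) has_derivative (\<lambda>h. bubble_grad y \<bullet> h)) (at (y + (0, 1)))"
    by (simp add: bubble_grad_def)
  moreover have "((\<lambda>y::'e \<times> real. y + (0, 1)) has_derivative (\<lambda>h. h)) (at y within half_space)"
    by (auto intro!: derivative_eq_intros)
  ultimately show ?thesis
    unfolding bubble0_eq[abs_def] by (rule has_derivative_compose[rotated])
qed

lemma continuous_on_bubble_grad: "continuous_on half_space (bubble_grad :: 'e::euclidean_space \<times> real \<Rightarrow> _)"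
proof -
  have "norm (y + (0, 1)) \<noteq> 0" if "y \<in> half_space" for y :: "'e \<times> real"
    using half_space_shift(1)[OF that] by linarith
  then show ?thesis
    unfolding bubble_grad_def[abs_def] by (intro continuous_intros) auto
qed

lemma norm_bubble_grad_sq:
  fixes y :: "'e::euclidean_space \<times> real"
  assumes "y \<in> half_space"
  shows "(norm (bubble_grad y))\<^sup>2
    = (2 - real DIM('e \<times> real))\<^sup>2 * norm (y + (0, 1)) powr - (2 * real DIM('e \<times> real) - 2)"
proof -
  let ?n = "real DIM('e \<times> real)" and ?z = "norm (y + (0, 1))"
  have z: "0 < ?z" using half_space_shift(1)[OF assms] by linarith
  have "(norm (bubble_grad y))\<^sup>2 = (2 - ?n)\<^sup>2 * ((?z powr - ?n)\<^sup>2 * ?z\<^sup>2)"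
    by (simp add: bubble_grad_def power_mult_distrib del: DIM_prod)
  also have "(?z powr - ?n)\<^sup>2 * ?z\<^sup>2 = ?z powr (- ?n + - ?n + 2)"
    using z by (simp only: powr_add power2_eq_square[of "_ powr _"]) (simp add: powr_realpow)
  also have "- ?n + - ?n + 2 = - (2 * ?n - 2)" by linarith
  finally show ?thesis .
qed

text \<open>The squared gradient decays with exponent 2n - 2, which exceeds the dimension n as soon
  as n \<ge> 3.\<close>

lemma set_integrable_bubble_grad:
  assumes "3 \<le> DIM('e \<times> real)"
  shows "set_integrable lborel half_space (\<lambda>y::'e::euclidean_space \<times> real. (norm (bubble_grad y))\<^sup>2)"
  unfolding set_integrable_def
proof (rule Bochner_Integration.integrable_bound)
  let ?n = "real DIM('e \<times> real)"
  let ?b = "\<lambda>y::'e \<times> real. (2 - ?n)\<^sup>2 * 2 powr (2 * ?n - 2) * (1 + norm y) powr - (2 * ?n - 2)"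
  have n: "3 \<le> ?n" using assms by linarith
  show "integrable lborel ?b"
    using n by (intro integrable_mult_right integrable_one_plus_norm_powr) linarith
  show "(\<lambda>y::'e \<times> real. indicator half_space y *\<^sub>R (norm (bubble_grad y))\<^sup>2) \<in> borel_measurable lborel"
    unfolding measurable_lborel2
    by (rule borel_measurable_continuous_on_indicator[OF half_space_sets_borel])
      (intro continuous_on_power continuous_on_norm continuous_on_bubble_grad)
  have "(norm (bubble_grad y))\<^sup>2 \<le> ?b y" if "y \<in> half_space" for y :: "'e \<times> real"
    unfolding norm_bubble_grad_sq[OF that] mult.assoc
    using n by (intro mult_left_mono half_space_shift_powr_le that) auto
  then show "AE y in lborel. norm (indicator half_space y *\<^sub>R (norm (bubble_grad y))\<^sup>2) \<le> norm (?b y)"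
    by (intro AE_I2) (simp add: indicator_def abs_mult del: DIM_prod)
qed

text \<open>No cutoff at a scale \<open>R \<ge> 1\<close> acts on the unit half-ball.\<close>

definition inner_energy :: "'e::euclidean_space itself \<Rightarrow> real" where
  "inner_energy _ = (LINT y:half_space \<inter> ball 0 1|lborel. (norm (bubble_grad (y :: 'e \<times> real)))\<^sup>2)"

lemma set_integrable_bubble_grad_ball:
  assumes "3 \<le> DIM('e \<times> real)"
  shows "set_integrable lborel (half_space \<inter> ball 0 1) (\<lambda>y::'e::euclidean_space \<times> real. (norm (bubble_grad y))\<^sup>2)"
  by (rule set_integrable_subset[OF set_integrable_bubble_grad[OF assms]])
    (simp_all add: half_space_sets_borel)

lemma inner_energy_pos:
  assumes "3 \<le> DIM('e \<times> real)"
  shows "0 < inner_energy TYPE('e::euclidean_space)"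
  unfolding inner_energy_def set_lebesgue_integral_def
proof (rule integral_pos_open)
  show "integrable lborel (\<lambda>y::'e \<times> real. indicator (half_space \<inter> ball 0 1) y *\<^sub>R (norm (bubble_grad y))\<^sup>2)"
    using set_integrable_bubble_grad_ball[OF assms] by (simp add: set_integrable_def)
  \<comment> \<open>\<open>half_space \<inter> ball 0 1\<close> is not open, so positivity is tested
    on its part y_n > 0; the gradient has no zero there because n \<noteq> 2.\<close>
  let ?U = "{y :: 'e \<times> real. 0 < snd y} \<inter> ball 0 1"
  show "open ?U" by (intro open_Int open_Collect_less continuous_intros) auto
  have "(0, 1 / 2) \<in> ?U" by (auto simp: norm_Pair)
  then show "?U \<noteq> {}" by blast
  fix y assume y: "y \<in> ?U"
  then have "y \<in> half_space" by (auto simp: half_space_def)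
  moreover from this have "0 < norm (y + (0, 1))" using half_space_shift(1)[of y] by linarith
  moreover have "2 - real DIM('e \<times> real) \<noteq> 0" using assms by linarith
  ultimately show "0 < indicator (half_space \<inter> ball 0 1) y *\<^sub>R (norm (bubble_grad y))\<^sup>2"
    using y by (simp add: norm_bubble_grad_sq del: DIM_prod)
qed auto

text \<open>\<open>U_plus\<close> divides by the square root of this number, and division by 0 would
  make it vanish identically. Integrability over the whole half-space matters here: a nonintegrable
  function would receive the integral 0.\<close>

lemma dirichlet_bubble0_pos:
  assumes "3 \<le> DIM('e \<times> real)"
  shows "0 < dirichlet (bubble0 :: 'e::euclidean_space \<times> real \<Rightarrow> real)"
proof -
  have "dirichlet (bubble0 :: 'e \<times> real \<Rightarrow> real) = (LINT y:half_space|lborel. (norm (bubble_grad (y :: 'e \<times> real)))\<^sup>2)"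
    by (rule dirichlet_gradient) (rule has_derivative_bubble0)
  then have "inner_energy TYPE('e) \<le> dirichlet (bubble0 :: 'e \<times> real \<Rightarrow> real)"
    unfolding inner_energy_def set_lebesgue_integral_def
    using set_integrable_bubble_grad[OF assms] set_integrable_bubble_grad_ball[OF assms]
    by (simp only: set_integrable_def set_lebesgue_integral_def)
      (rule integral_mono, simp_all add: indicator_def)
  then show ?thesis using inner_energy_pos[OF assms] by linarith
qed

section \<open>The cutoff and the truncated bubbles\<close>

lemma locally_constant_gradient:
  fixes f :: "'v::real_inner \<Rightarrow> real"
  assumes "(f has_derivative (\<lambda>h. g \<bullet> h)) (at z)" "open U" "z \<in> U" "\<And>x. x \<in> U \<Longrightarrow> f x = c"
  shows "g = 0"
proof -
  have "(f has_derivative (\<lambda>h. 0)) (at z)"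
    by (rule has_derivative_transform_within_open[OF has_derivative_const assms(2,3)])
      (simp add: assms(4))
  with assms(1) have "(\<lambda>h. g \<bullet> h) = (\<lambda>h. 0)" by (rule has_derivative_unique)
  then show ?thesis by (metis inner_eq_zero_iff)
qed

text \<open>Collects what the estimates take from a cutoff: a continuous gradient field, the regions
  where that field vanishes, and a uniform bound. The inequalities on |z| are strict so that these
  regions are open and \<open>locally_constant_gradient\<close> applies.\<close>

lemma radial_cutoffE:
  fixes \<eta> :: "'e::euclidean_space \<times> real \<Rightarrow> real"
  assumes "radial_cutoff \<eta>"
  obtains G B where
    "\<And>z. (\<eta> has_derivative (\<lambda>h. G z \<bullet> h)) (at z)" "continuous_on UNIV G"
    "\<And>z. norm z < 1 \<Longrightarrow> \<eta> z = 1 \<and> G z = 0" "\<And>z. 2 < norm z \<Longrightarrow> \<eta> z = 0 \<and> G z = 0"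
    "\<And>z. \<bar>\<eta> z\<bar> \<le> B"
proof -
  \<comment> \<open>\<open>G z\<close> is the vector representing the derivative at
    \<open>z\<close>, assembled from its values on the orthonormal basis.\<close>
  define G where "G z = (\<Sum>b\<in>Basis. frechet_derivative \<eta> (at z) b *\<^sub>R b)" for z
  have "Ck_on (Suc 0) UNIV \<eta>" using assms unfolding radial_cutoff_def smooth_on_def by blast
  then have diff: "\<eta> differentiable (at z)"
    and cont: "continuous_on UNIV (\<lambda>z. frechet_derivative \<eta> (at z) v)" for z v
    by (auto simp: differentiable_on_def simp del: split_paired_All)
  have G: "(\<eta> has_derivative (\<lambda>h. G z \<bullet> h)) (at z)" for z
  proof -
    have D: "(\<eta> has_derivative frechet_derivative \<eta> (at z)) (at z)"
      using diff frechet_derivative_works by blast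
    then have lin: "linear (frechet_derivative \<eta> (at z))" by (rule has_derivative_linear)
    have "frechet_derivative \<eta> (at z) h = G z \<bullet> h" for h
    proof -
      have "frechet_derivative \<eta> (at z) h = frechet_derivative \<eta> (at z) (\<Sum>b\<in>Basis. (h \<bullet> b) *\<^sub>R b)"
        by (simp add: euclidean_representation)
      also have "\<dots> = (\<Sum>b\<in>Basis. (h \<bullet> b) * frechet_derivative \<eta> (at z) b)"
        by (simp add: linear_sum[OF lin] linear_cmul[OF lin])
      also have "\<dots> = G z \<bullet> h"
        by (simp add: G_def inner_sum_left) (simp add: inner_commute mult.commute)
      finally show ?thesis .
    qed
    then have "frechet_derivative \<eta> (at z) = (\<lambda>h. G z \<bullet> h)" by blast
    with D show ?thesis by simp
  qed
  have contG: "continuous_on UNIV G"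
    unfolding G_def by (intro continuous_intros cont)
  have one: "\<eta> z = 1" if "z \<in> ball 0 1" for z
    using assms that by (auto simp: radial_cutoff_def)
  have zero: "\<eta> z = 0" if "z \<in> - cball 0 2" for z
    using assms that closure_subset[of "{y. \<eta> y \<noteq> 0}"] by (auto simp: radial_cutoff_def)
  have "continuous_on UNIV \<eta>"
    by (rule has_derivative_continuous_on) (rule G)
  then have "continuous_on (cball 0 2) \<eta>"
    by (rule continuous_on_subset) simp
  then have "bounded (\<eta> ` cball 0 2)"
    by (intro compact_imp_bounded compact_continuous_image compact_cball)
  then obtain B where "\<forall>z\<in>cball 0 2. norm (\<eta> z) \<le> B"
    unfolding bounded_iff by blast
  \<comment> \<open>Off \<open>cball 0 2\<close> the cutoff is 0, which \<open>max B 0\<close>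
    covers without determining the sign of \<open>B\<close>.\<close>
  then have B: "\<bar>\<eta> z\<bar> \<le> max B 0" for z
    using zero[of z] by (cases "z \<in> cball 0 2") (simp_all add: max.coboundedI1)
  show thesis
  proof (rule that[OF G contG _ _ B])
    show "\<eta> z = 1 \<and> G z = 0" if "norm z < 1" for z
      using locally_constant_gradient[OF G open_ball[of 0 1] _ one, of z] one[of z] that by simp
    show "\<eta> z = 0 \<and> G z = 0" if "2 < norm z" for z
      using locally_constant_gradient[OF G open_Compl[OF closed_cball[of 0 2]] _ zero, of z] zero[of z] that by simp
  qed
qed

lemma has_derivative_cut_bubble:
  fixes \<eta> :: "'e::euclidean_space \<times> real \<Rightarrow> real"
  assumes "\<And>z. (\<eta> has_derivative (\<lambda>h. G z \<bullet> h)) (at z)" "y \<in> half_space"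
  defines "d \<equiv> sqrt (dirichlet (bubble0 :: 'e \<times> real \<Rightarrow> real))"
  shows "(cut_bubble \<eta> R has_derivative (\<lambda>h. ((\<eta> ((1 / R) *\<^sub>R y) / d) *\<^sub>R bubble_grad y
      + (bubble0 y / (d * R)) *\<^sub>R G ((1 / R) *\<^sub>R y)) \<bullet> h)) (at y within half_space)"
proof -
  have "((\<lambda>y. (1 / R) *\<^sub>R y) has_derivative (\<lambda>h. (1 / R) *\<^sub>R h)) (at y within half_space)"
    by (auto intro!: derivative_eq_intros)
  then have "((\<lambda>y. \<eta> ((1 / R) *\<^sub>R y)) has_derivative (\<lambda>h. G ((1 / R) *\<^sub>R y) \<bullet> (1 / R) *\<^sub>R h))
      (at y within half_space)"
    using assms(1) by (rule has_derivative_compose)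
  moreover have "((\<lambda>y. bubble0 y / d) has_derivative (\<lambda>h. (bubble_grad y \<bullet> h) / d)) (at y within half_space)"
    using has_derivative_mult_right[OF has_derivative_bubble0[OF assms(2)], of "1 / d"] by simp
  ultimately have "((\<lambda>y. \<eta> ((1 / R) *\<^sub>R y) * (bubble0 y / d)) has_derivative
      (\<lambda>h. \<eta> ((1 / R) *\<^sub>R y) * ((bubble_grad y \<bullet> h) / d) + (G ((1 / R) *\<^sub>R y) \<bullet> (1 / R) *\<^sub>R h) * (bubble0 y / d)))
      (at y within half_space)"
    by (rule has_derivative_mult)
  then show ?thesis
    by (simp add: cut_bubble_def[abs_def] U_plus_def d_def inner_add_left mult_ac)
qed

text \<open>On the unit half-ball the truncated bubble has the gradient of the normalized bubble,
  whose square is the squared \<open>bubble_grad\<close> divided by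
  \<open>dirichlet bubble0\<close>. The rest of the half-space contributes a nonnegative amount. The
  bound does not depend on \<open>R\<close>.\<close>

lemma dirichlet_cut_bubble_ge:
  fixes \<eta> :: "'e::euclidean_space \<times> real \<Rightarrow> real"
  assumes "radial_cutoff \<eta>" "3 \<le> DIM('e \<times> real)" "1 \<le> R"
  shows "inner_energy TYPE('e) / dirichlet (bubble0 :: 'e \<times> real \<Rightarrow> real) \<le> dirichlet (cut_bubble \<eta> R)"
proof -
  obtain G B where G: "\<And>z. (\<eta> has_derivative (\<lambda>h. G z \<bullet> h)) (at z)" "continuous_on UNIV G"
    and one: "\<And>z. norm z < 1 \<Longrightarrow> \<eta> z = 1 \<and> G z = 0"
    and zero: "\<And>z. 2 < norm z \<Longrightarrow> \<eta> z = 0 \<and> G z = 0"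
    using radial_cutoffE[OF assms(1)] by metis
  let ?d = "sqrt (dirichlet (bubble0 :: 'e \<times> real \<Rightarrow> real))"
  define g where "g y = (\<eta> ((1 / R) *\<^sub>R y) / ?d) *\<^sub>R bubble_grad y
      + (bubble0 y / (?d * R)) *\<^sub>R G ((1 / R) *\<^sub>R y)" for y
  let ?K = "half_space \<inter> cball 0 (2 * R) :: ('e \<times> real) set"
  have D: "0 < dirichlet (bubble0 :: 'e \<times> real \<Rightarrow> real)" by (rule dirichlet_bubble0_pos[OF assms(2)])
  have cont: "continuous_on half_space g"
  proof -
    have scale: "continuous_on half_space (\<lambda>y :: 'e \<times> real. (1 / R) *\<^sub>R y)"
      by (intro continuous_intros)
    have "continuous_on UNIV \<eta>"
      by (rule has_derivative_continuous_on) (rule G)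
    then have "continuous_on half_space (\<lambda>y. \<eta> ((1 / R) *\<^sub>R y))"
      using scale by (rule continuous_on_compose2) simp
    moreover have "continuous_on half_space (\<lambda>y. G ((1 / R) *\<^sub>R y))"
      using G(2) scale by (rule continuous_on_compose2) simp
    moreover have "continuous_on half_space (bubble0 :: 'e \<times> real \<Rightarrow> real)"
      by (rule has_derivative_continuous_on) (rule has_derivative_bubble0)
    ultimately show ?thesis
      unfolding g_def using D assms(3)
      by (intro continuous_on_add continuous_on_scaleR continuous_on_divide continuous_on_const
          continuous_on_bubble_grad) simp_all
  qed
  \<comment> \<open>The comparison of integrals needs an integrable upper function. The gradient
    \<open>g\<close> is continuous and vanishes beyond radius 2R, since the cutoff and its gradient
    do.\<close>
  have "compact ?K" by (intro closed_Int_compact closed_half_space compact_cball)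
  then have "integrable lborel (\<lambda>y. indicator ?K y *\<^sub>R (norm (g y))\<^sup>2)"
    by (rule borel_integrable_compact)
      (intro continuous_on_power continuous_on_norm continuous_on_subset[OF cont] Int_lower1)
  moreover have "indicator ?K y *\<^sub>R (norm (g y))\<^sup>2 = indicator half_space y *\<^sub>R (norm (g y))\<^sup>2" for y
  proof (cases "norm y \<le> 2 * R")
    case False
    then have "2 < norm ((1 / R) *\<^sub>R y)" using assms(3) by (simp add: field_simps)
    then have "g y = 0" using zero by (simp add: g_def)
    then show ?thesis by simp
  qed (auto simp: indicator_def)
  ultimately have int: "integrable lborel (\<lambda>y. indicator half_space y *\<^sub>R (norm (g y))\<^sup>2)"
    by (simp only:)
  have ge: "indicator (half_space \<inter> ball 0 1) y *\<^sub>R (norm (bubble_grad y))\<^sup>2 / dirichlet (bubble0 :: 'e \<times> real \<Rightarrow> real)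
      \<le> indicator half_space y *\<^sub>R (norm (g y))\<^sup>2" for y :: "'e \<times> real"
  proof (cases "y \<in> half_space \<inter> ball 0 1")
    case True
    then have "norm ((1 / R) *\<^sub>R y) < 1" using assms(3) by (auto simp: field_simps)
    then have "g y = (1 / ?d) *\<^sub>R bubble_grad y" using one by (simp add: g_def)
    then show ?thesis using True D by (simp add: power_divide)
  qed (auto simp: indicator_def)
  have "inner_energy TYPE('e) / dirichlet (bubble0 :: 'e \<times> real \<Rightarrow> real)
      = (LINT y|lborel. indicator (half_space \<inter> ball 0 1) y *\<^sub>R (norm (bubble_grad (y :: 'e \<times> real)))\<^sup>2
          / dirichlet (bubble0 :: 'e \<times> real \<Rightarrow> real))"
    by (simp add: inner_energy_def set_lebesgue_integral_def)
  also have "\<dots> \<le> (LINT y|lborel. indicator half_space y *\<^sub>R (norm (g y))\<^sup>2)"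
    using set_integrable_bubble_grad_ball[OF assms(2)] int ge
    by (intro integral_mono) (auto simp: set_integrable_def)
  also have "\<dots> = dirichlet (cut_bubble \<eta> R)"
    using dirichlet_gradient[where w = "cut_bubble \<eta> R" and g = g] has_derivative_cut_bubble[OF G(1)]
    by (simp add: g_def set_lebesgue_integral_def)
  finally show ?thesis .
qed

text \<open>The upper bound is the integral of a majorant independent of \<open>R\<close>;
  positivity comes from the unit ball of the boundary, where the cutoff equals 1 for R \<ge>
  1.\<close>

lemma trace_cut_bubble_bounds:
  fixes \<eta> :: "'e::euclidean_space \<times> real \<Rightarrow> real"
  assumes "radial_cutoff \<eta>" "3 \<le> DIM('e \<times> real)"
  obtains C where "\<And>R. 1 \<le> R \<Longrightarrow> 0 < (LINT y|lborel. \<bar>cut_bubble \<eta> R (y, 0)\<bar> powr q_exp TYPE('e))"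
    and "\<And>R. 1 \<le> R \<Longrightarrow> (LINT y|lborel. \<bar>cut_bubble \<eta> R (y, 0)\<bar> powr q_exp TYPE('e)) \<le> C"
proof -
  obtain G B where G: "\<And>z. (\<eta> has_derivative (\<lambda>h. G z \<bullet> h)) (at z)"
    and one: "\<And>z. norm z < 1 \<Longrightarrow> \<eta> z = 1 \<and> G z = 0" and B: "\<And>z. \<bar>\<eta> z\<bar> \<le> B"
    using radial_cutoffE[OF assms(1)] by metis
  let ?n = "real DIM('e \<times> real)" and ?q = "q_exp TYPE('e)"
  let ?d = "sqrt (dirichlet (bubble0 :: 'e \<times> real \<Rightarrow> real))"
  have n: "3 \<le> ?n" using assms(2) by linarith
  have d: "0 < ?d" using dirichlet_bubble0_pos[OF assms(2)] by simp
  \<comment> \<open>For the critical exponent, (n - 2) q = 2n - 2: the q-th power of the trace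
    decays at the rate of the squared gradient.\<close>
  have q: "0 < ?q" "(2 - ?n) * ?q = - (2 * ?n - 2)"
    using n by (simp_all add: q_exp_def field_simps del: DIM_prod)
  have B0: "0 \<le> B" using B[of 0] by simp
  let ?b = "\<lambda>y::'e. (B / ?d) powr ?q * 2 powr (2 * ?n - 2) * (1 + norm y) powr - (2 * ?n - 2)"
  \<comment> \<open>The boundary model has dimension n - 1, and 2n - 2 > n - 1.\<close>
  have b: "integrable lborel ?b"
    using n by (intro integrable_mult_right integrable_one_plus_norm_powr) simp
  have half: "(y, 0) \<in> half_space" for y :: 'e by (simp add: half_space_def)
  have le: "\<bar>cut_bubble \<eta> R (y, 0)\<bar> powr ?q \<le> ?b y" for R and y :: 'e
  proof -
    have "\<bar>cut_bubble \<eta> R (y, 0)\<bar> = \<bar>\<eta> ((1 / R) *\<^sub>R (y, 0))\<bar> / ?d * bubble0 (y, 0)"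
      using d by (simp add: cut_bubble_def U_plus_def abs_mult bubble0_eq)
    also have "\<dots> \<le> B / ?d * bubble0 (y, 0)"
      using B d by (intro mult_right_mono divide_right_mono) (auto simp: bubble0_eq)
    finally have "\<bar>cut_bubble \<eta> R (y, 0)\<bar> powr ?q \<le> (B / ?d * bubble0 (y, 0)) powr ?q"
      using q(1) by (intro powr_mono2) auto
    also have "\<dots> = (B / ?d) powr ?q * norm ((y, 0) + (0, 1 :: real)) powr - (2 * ?n - 2)"
      using B0 d by (simp only: powr_mult bubble0_eq powr_powr q(2))
    also have "\<dots> \<le> (B / ?d) powr ?q * (2 powr (2 * ?n - 2) * (1 + norm (y, 0 :: real)) powr - (2 * ?n - 2))"
      using n by (intro mult_left_mono half_space_shift_powr_le half) auto
    finally show ?thesis by (simp add: mult.assoc norm_Pair)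
  qed
  have int: "integrable lborel (\<lambda>y. \<bar>cut_bubble \<eta> R (y, 0)\<bar> powr ?q)" for R
  proof (rule Bochner_Integration.integrable_bound[OF b])
    have "continuous_on half_space (cut_bubble \<eta> R)"
      using has_derivative_cut_bubble[OF G] has_derivative_continuous continuous_on_eq_continuous_within by blast
    then have "continuous_on UNIV (\<lambda>y. cut_bubble \<eta> R (y, 0))"
      by (rule continuous_on_compose2) (auto intro: continuous_intros half)
    then have [measurable]: "(\<lambda>y. cut_bubble \<eta> R (y, 0)) \<in> borel_measurable borel"
      by (rule borel_measurable_continuous_onI)
    show "(\<lambda>y. \<bar>cut_bubble \<eta> R (y, 0)\<bar> powr ?q) \<in> borel_measurable lborel" by measurable
    show "AE y in lborel. norm (\<bar>cut_bubble \<eta> R (y, 0)\<bar> powr ?q) \<le> norm (?b y)"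
      using le by (intro AE_I2) (simp add: abs_mult del: DIM_prod)
  qed
  show thesis
  proof (rule that)
    fix R :: real assume R: "1 \<le> R"
    show "(LINT y|lborel. \<bar>cut_bubble \<eta> R (y, 0)\<bar> powr ?q) \<le> integral\<^sup>L lborel ?b"
      by (intro integral_mono int b le)
    show "0 < (LINT y|lborel. \<bar>cut_bubble \<eta> R (y, 0)\<bar> powr ?q)"
    proof (rule integral_pos_open[OF int])
      fix y :: 'e assume "y \<in> ball 0 1"
      then have "norm ((1 / R) *\<^sub>R (y, 0 :: real)) < 1"
        using R by (simp add: norm_Pair[of y] divide_less_eq del: scaleR_Pair)
      moreover have "0 < norm ((y, 0) + (0, 1 :: real))"
        using half_space_shift(1)[OF half[of y]] by linarith
      ultimately show "0 < \<bar>cut_bubble \<eta> R (y, 0)\<bar> powr ?q"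
        using one d by (simp add: cut_bubble_def U_plus_def bubble0_eq)
    qed auto
  qed
qed

section \<open>Positivity of the hemisphere constant\<close>

lemma S_trunc_lower_bound:
  fixes \<eta> :: "'e::euclidean_space \<times> real \<Rightarrow> real"
  assumes "radial_cutoff \<eta>" "3 \<le> DIM('e \<times> real)"
  obtains c where "0 < c" "\<And>R. 1 \<le> R \<Longrightarrow> c \<le> S_trunc \<eta> R"
proof -
  let ?e = "inner_energy TYPE('e) / dirichlet (bubble0 :: 'e \<times> real \<Rightarrow> real)"
  let ?q = "q_exp TYPE('e)" and ?I = "\<lambda>R. LINT y|lborel. \<bar>cut_bubble \<eta> R (y, 0)\<bar> powr q_exp TYPE('e)"
  obtain C where C: "\<And>R. 1 \<le> R \<Longrightarrow> 0 < ?I R" "\<And>R. 1 \<le> R \<Longrightarrow> ?I R \<le> C"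
    using trace_cut_bubble_bounds[OF assms] by blast
  have C0: "0 < C" using C[of 1] by linarith
  have e: "0 < ?e" using inner_energy_pos[OF assms(2)] dirichlet_bubble0_pos[OF assms(2)] by simp
  have q: "0 < ?q" using assms(2) by (simp add: q_exp_def)
  show thesis
  proof
    show "0 < ?e / C powr (2 / ?q)" using divide_pos_pos[OF e, of "C powr (2 / ?q)"] C0 by simp
    fix R :: real assume R: "1 \<le> R"
    have "?I R powr (2 / ?q) \<le> C powr (2 / ?q)"
      using C[OF R] q by (intro powr_mono2) auto
    \<comment> \<open>Strict positivity is essential: a zero denominator would make the quotient 0
      and defeat the lower bound.\<close>
    moreover have "0 < ?I R powr (2 / ?q)" using C(1)[OF R] by simp
    ultimately show "?e / C powr (2 / ?q) \<le> S_trunc \<eta> R"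
      unfolding S_trunc_def using dirichlet_cut_bubble_ge[OF assms R] e
      by (intro frac_le) auto
  qed
qed

text \<open>The truncation clause of \<open>admissible_diagonal\<close> makes \<open>S_star\<close>
  the limit of \<open>S_trunc\<close> along the diagonal, where eventually Rd \<ge> 1; the limit
  inherits the positive lower bound.\<close>

lemma S_star_pos:
  fixes A :: "('a::t2_space, 'i, 'e::euclidean_space \<times> real) riem"
  assumes "radial_cutoff \<eta>" "3 \<le> DIM('e \<times> real)" "admissible_diagonal A \<rho> \<eta> Rd"
  shows "0 < S_star TYPE('e)"
proof -
  obtain c where c: "0 < c" "\<And>R. 1 \<le> R \<Longrightarrow> c \<le> S_trunc \<eta> R"
    using S_trunc_lower_bound[OF assms(1,2)] by blast
  have "(\<lambda>\<epsilon>. S_trunc \<eta> (Rd \<epsilon>) - S_star TYPE('e)) \<in> O[at_right 0](\<lambda>\<epsilon>. \<epsilon>^4)"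
    and Rd: "filterlim Rd at_top (at_right 0)"
    using assms(3) by (auto simp: admissible_diagonal_def)
  then obtain C where "\<forall>\<^sub>F \<epsilon> in at_right 0. norm (S_trunc \<eta> (Rd \<epsilon>) - S_star TYPE('e)) \<le> C * norm (\<epsilon>^4)"
    using landau_o.bigE by blast
  moreover have "((\<lambda>\<epsilon>::real. C * norm (\<epsilon>^4)) \<longlongrightarrow> 0) (at_right 0)"
    by (auto intro!: tendsto_eq_intros)
  ultimately have "((\<lambda>\<epsilon>. S_trunc \<eta> (Rd \<epsilon>) - S_star TYPE('e)) \<longlongrightarrow> 0) (at_right 0)"
    by (rule Lim_null_comparison)
  then have "((\<lambda>\<epsilon>. S_trunc \<eta> (Rd \<epsilon>)) \<longlongrightarrow> S_star TYPE('e)) (at_right 0)"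
    by (simp add: LIM_zero_iff)
  moreover have "\<forall>\<^sub>F \<epsilon> in at_right 0. c \<le> S_trunc \<eta> (Rd \<epsilon>)"
    using filterlim_at_top[THEN iffD1, OF Rd, rule_format, of 1] by eventually_elim (rule c(2))
  ultimately have "c \<le> S_star TYPE('e)"
    using tendsto_lowerbound by force
  then show ?thesis using c(1) by linarith
qed

section \<open>Compactness of the boundary\<close>

text \<open>A point is off the boundary exactly when some chart gives it a positive last coordinate,
  and this is a relatively open condition. The boundary is therefore closed in a compact
  set.\<close>

lemma compact_bdry:
  assumes "compact_riem_mfd A"
  shows "compact (bdry A)"
proof -
  let ?int = "\<lambda>i. {p \<in> chart_dom A i. 0 < snd (coord A i p)}"
  have cpt: "compact (pts A)" and cover: "pts A = (\<Union>i\<in>idx A. chart_dom A i)"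
    using assms by (auto simp: compact_riem_mfd_def)
  have "openin (top_of_set (pts A)) (?int i)" if "i \<in> idx A" for i
  proof -
    have dom: "openin (top_of_set (pts A)) (chart_dom A i)"
      and hom: "homeomorphism (chart_dom A i) (chart_img A i) (coord A i) (chart_inv A i)"
      using assms that by (auto simp: compact_riem_mfd_def)
    have "continuous_on (chart_dom A i) (\<lambda>p. snd (coord A i p))"
      using homeomorphism_cont1[OF hom] by (intro continuous_intros)
    then have "openin (top_of_set (chart_dom A i))
        (chart_dom A i \<inter> (\<lambda>p. snd (coord A i p)) -` {0<..})"
      by (intro continuous_openin_preimage_gen) auto
    also have "chart_dom A i \<inter> (\<lambda>p. snd (coord A i p)) -` {0<..} = ?int i" by auto
    finally show ?thesis using dom openin_trans by blast
  qed
  then have "openin (top_of_set (pts A)) (\<Union>i\<in>idx A. ?int i)" by blast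
  then have "closedin (top_of_set (pts A)) (pts A - (\<Union>i\<in>idx A. ?int i))"
    by (intro closedin_diff) auto
  moreover have "bdry A = pts A - (\<Union>i\<in>idx A. ?int i)" by (auto simp: bdry_def)
  ultimately show ?thesis using cpt closedin_compact by metis
qed

section \<open>Finite differences at three scales\<close>

text \<open>Up to remainders, A_k is S (R k \<epsilon> + T k^2 \<epsilon>^2). The second difference
  over k = 1, 2, 3 isolates \<open>T\<close>, and the first difference then gives \<open>R\<close>
  once its contribution from \<open>T\<close> is subtracted.\<close>

lemma three_scale_estimators:
  fixes E :: "real \<Rightarrow> real"
  assumes "0 < S" "0 < \<epsilon>"
    and expansion: "\<And>k. k \<in> {1, 2, 3} \<Longrightarrow>
      \<bar>E (k * \<epsilon>) - S * (R * (k * \<epsilon>)^2 + T * (k * \<epsilon>)^3)\<bar> \<le> C * (k * \<epsilon>)^4"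
  shows "\<bar>R_hat S E \<epsilon> - R\<bar> \<le> 75 * C / S * \<epsilon>^2"
    and "\<bar>Theta_hat S E \<epsilon> - T\<bar> \<le> 22 * C / S * \<epsilon>"
proof -
  \<comment> \<open>The remainder of A_k: division by k \<epsilon> lowers the order of the error by
    one, whence the bound C k^3 \<epsilon>^3.\<close>
  define r where "r k = quotA E \<epsilon> k - S * (R * (k * \<epsilon>) + T * (k * \<epsilon>)^2)" for k
  have r: "\<bar>r k\<bar> \<le> C * k^3 * \<epsilon>^3" if k: "k \<in> {1, 2, 3}" for k
  proof -
    have pos: "0 < k * \<epsilon>" using k assms(2) by auto
    have "E h / h - S * (R * h + T * h^2) = (E h - S * (R * h^2 + T * h^3)) / h" if "h \<noteq> 0" for h
    proof -
      have "E h - S * (R * h^2 + T * h^3) = E h - S * (R * h + T * h^2) * h"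
        by (simp add: algebra_simps power2_eq_square power3_eq_cube)
      then show ?thesis
        by (simp only: diff_divide_distrib nonzero_mult_div_cancel_right[OF that])
    qed
    from this[OF less_imp_neq[OF pos, symmetric]] have "r k = (E (k * \<epsilon>) - S * (R * (k * \<epsilon>)^2 + T * (k * \<epsilon>)^3)) / (k * \<epsilon>)"
      by (simp only: r_def quotA_def)
    then have "\<bar>r k\<bar> = \<bar>E (k * \<epsilon>) - S * (R * (k * \<epsilon>)^2 + T * (k * \<epsilon>)^3)\<bar> / (k * \<epsilon>)"
      using pos by (simp only: abs_divide abs_of_pos)
    also have "\<dots> \<le> C * (k * \<epsilon>)^4 / (k * \<epsilon>)"
      using expansion[OF k] less_imp_le[OF pos] by (rule divide_right_mono)
    also have "C * (k * \<epsilon>)^4 = C * k^3 * \<epsilon>^3 * (k * \<epsilon>)"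
      by (simp add: power_mult_distrib power3_eq_cube power4_eq_xxxx)
    also have "\<dots> / (k * \<epsilon>) = C * k^3 * \<epsilon>^3"
      using pos by (intro nonzero_mult_div_cancel_right) linarith
    finally show ?thesis .
  qed
  have r1: "\<bar>r 1\<bar> \<le> C * \<epsilon>^3" and r2: "\<bar>r 2\<bar> \<le> 8 * C * \<epsilon>^3" and r3: "\<bar>r 3\<bar> \<le> 27 * C * \<epsilon>^3"
    using r[of 1] r[of 2] r[of 3] by simp_all
  have q: "quotA E \<epsilon> k = S * (R * (k * \<epsilon>) + T * (k * \<epsilon>)^2) + r k" for k
    by (simp add: r_def)
  \<comment> \<open>The second difference kills the term linear in k and takes the value 2 on k^2,
    which accounts for the factor 2 in \<open>Theta_hat\<close>.\<close>
  have T: "Theta_hat S E \<epsilon> - T = (r 3 - 2 * r 2 + r 1) / (2 * S * \<epsilon>^2)"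
  proof -
    have "Delta2 E \<epsilon> - Delta1 E \<epsilon> = T * (2 * S * \<epsilon>^2) + (r 3 - 2 * r 2 + r 1)"
      unfolding Delta1_def Delta2_def q by (simp add: algebra_simps power2_eq_square)
    moreover have nz: "2 * S * \<epsilon>^2 \<noteq> 0" using assms(1,2) by simp
    ultimately show ?thesis
      unfolding Theta_hat_def by (simp only: add_divide_distrib nonzero_mult_div_cancel_right[OF nz])
  qed
  have d: "\<bar>2 * S * \<epsilon>^2\<bar> = 2 * S * \<epsilon>^2" "\<bar>S * \<epsilon>\<bar> = S * \<epsilon>" "0 \<le> 2 * S * \<epsilon>^2" "0 \<le> S * \<epsilon>"
    using assms(1,2) by simp_all
  \<comment> \<open>44 = 27 + 2 * 8 + 1, from the cubes of the three scale factors.\<close>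
  have "\<bar>r 3 - 2 * r 2 + r 1\<bar> \<le> 44 * C * \<epsilon>^3" using r1 r2 r3 by linarith
  then have "\<bar>Theta_hat S E \<epsilon> - T\<bar> \<le> 44 * C * \<epsilon>^3 / (2 * S * \<epsilon>^2)"
    unfolding T abs_divide d using d(3) by (rule divide_right_mono)
  also have "\<dots> = 22 * C / S * \<epsilon>"
    using assms(1,2) by (simp add: power2_eq_square power3_eq_cube)
  finally show Tle: "\<bar>Theta_hat S E \<epsilon> - T\<bar> \<le> 22 * C / S * \<epsilon>" .
  \<comment> \<open>The first difference of k^2 is 2^2 - 1^2 = 3, so Delta1 / (S \<epsilon>)
    contains 3 \<epsilon> T. The correction in \<open>R_hat\<close> removes it up to the error of
    \<open>Theta_hat\<close>.\<close>
  have R: "R_hat S E \<epsilon> - R = (r 2 - r 1) / (S * \<epsilon>) - 3 * \<epsilon> * (Theta_hat S E \<epsilon> - T)"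
  proof -
    have "Delta1 E \<epsilon> = (R + 3 * \<epsilon> * T) * (S * \<epsilon>) + (r 2 - r 1)"
      unfolding Delta1_def q by (simp add: algebra_simps power2_eq_square)
    moreover have nz: "S * \<epsilon> \<noteq> 0" using assms(1,2) by simp
    ultimately have "Delta1 E \<epsilon> / (S * \<epsilon>) = R + 3 * \<epsilon> * T + (r 2 - r 1) / (S * \<epsilon>)"
      by (simp only: add_divide_distrib nonzero_mult_div_cancel_right[OF nz])
    then show ?thesis
      unfolding R_hat_def by (simp add: right_diff_distrib)
  qed
  have "\<bar>r 2 - r 1\<bar> \<le> 9 * C * \<epsilon>^3" using r1 r2 by linarith
  then have "\<bar>(r 2 - r 1) / (S * \<epsilon>)\<bar> \<le> 9 * C * \<epsilon>^3 / (S * \<epsilon>)"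
    unfolding abs_divide d using d(4) by (rule divide_right_mono)
  also have "\<dots> = 9 * C / S * \<epsilon>^2"
    using assms(1,2) by (simp add: power2_eq_square power3_eq_cube)
  finally have "\<bar>(r 2 - r 1) / (S * \<epsilon>)\<bar> \<le> 9 * C / S * \<epsilon>^2" .
  \<comment> \<open>9 = 8 + 1 comes from the remainders in the first difference, 66 = 3 * 22 from
    the error of \<open>Theta_hat\<close>.\<close>
  moreover have "9 * C / S * \<epsilon>^2 + 66 * C / S * \<epsilon>^2 = 75 * C / S * \<epsilon>^2"
    by simp
  moreover have "\<bar>3 * \<epsilon> * (Theta_hat S E \<epsilon> - T)\<bar> \<le> 66 * C / S * \<epsilon>^2"
  proof -
    have "\<bar>3 * \<epsilon> * (Theta_hat S E \<epsilon> - T)\<bar> = 3 * \<epsilon> * \<bar>Theta_hat S E \<epsilon> - T\<bar>"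
      using assms(2) by (simp only: abs_mult)
    also have "\<dots> \<le> 3 * \<epsilon> * (22 * C / S * \<epsilon>)"
      by (rule mult_left_mono[OF Tle]) (use assms(2) in simp)
    also have "\<dots> = 66 * C / S * \<epsilon>^2" by (simp add: power2_eq_square)
    finally show ?thesis .
  qed
  ultimately show "\<bar>R_hat S E \<epsilon> - R\<bar> \<le> 75 * C / S * \<epsilon>^2"
    unfolding R by linarith
qed

section \<open>The uniform error bounds\<close>

theorem theorem3p10:
  fixes A :: "('a::t2_space, 'i, 'e::euclidean_space \<times> real) riem"
    and \<rho> :: real
    and \<eta> :: "'e \<times> real \<Rightarrow> real"
    and Rd :: "real \<Rightarrow> real"
  assumes "7 \<le> DIM('e \<times> real)"
    and "compact_riem_mfd A"
    and "yamabe_pos A"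
    and "BG4plus A"
    and "\<forall>x\<in>bdry A. mean_curv A x = 0"
    and "fermi_radius A \<rho>"
    and "radial_cutoff \<eta>"
    and "admissible_diagonal A \<rho> \<eta> Rd"
  shows "\<exists>C. \<exists>\<epsilon>0>0. \<forall>x\<in>bdry A. \<forall>\<epsilon>. 0 < \<epsilon> \<and> \<epsilon> < \<epsilon>0 \<longrightarrow>
           \<bar>R_hat (S_star TYPE('e)) (bubble_energy A \<rho> \<eta> Rd x) \<epsilon> - R_bare A \<rho> \<eta> x\<bar> \<le> C * \<epsilon>^2 \<and>
           \<bar>Theta_hat (S_star TYPE('e)) (bubble_energy A \<rho> \<eta> Rd x) \<epsilon> - Theta A \<rho> \<eta> x\<bar> \<le> C * \<epsilon>"
proof -
  have S: "0 < S_star TYPE('e)"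
    using S_star_pos[OF assms(7) _ assms(8)] assms(1) by linarith
  \<comment> \<open>Taking the whole boundary as the compact set in
    \<open>admissible_diagonal\<close> makes the constants independent of the base point.\<close>
  have "compact (bdry A) \<and> bdry A \<subseteq> bdry A" using compact_bdry[OF assms(2)] by simp
  note assms(8)[unfolded admissible_diagonal_def, THEN conjunct2, THEN conjunct2, THEN conjunct2,
      THEN spec, THEN mp, OF this]
  then obtain C \<epsilon>0 where \<epsilon>0: "0 < \<epsilon>0" and expansion: "\<forall>x\<in>bdry A. \<forall>\<epsilon>. 0 < \<epsilon> \<and> \<epsilon> < \<epsilon>0 \<longrightarrow>
      \<bar>bubble_energy A \<rho> \<eta> Rd x \<epsilon>
        - S_star TYPE('e) * (R_bare A \<rho> \<eta> x * \<epsilon>^2 + Theta A \<rho> \<eta> x * \<epsilon>^3)\<bar> \<le> C * \<epsilon>^4"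
    by blast
  \<comment> \<open>The larger of the factors 75 and 22 serves both estimates; the absolute value
    makes the comparison valid, as no sign of \<open>C\<close> is given.\<close>
  let ?C = "75 * \<bar>C\<bar> / S_star TYPE('e)"
  show ?thesis
  proof (intro exI conjI ballI allI impI)
    \<comment> \<open>A third of the threshold keeps all of \<epsilon>, 2 \<epsilon> and 3
      \<epsilon> inside the range of the expansion.\<close>
    show "0 < \<epsilon>0 / 3" using \<epsilon>0 by simp
    fix x \<epsilon> assume x: "x \<in> bdry A" and \<epsilon>: "0 < \<epsilon> \<and> \<epsilon> < \<epsilon>0 / 3"
    have scales: "\<bar>bubble_energy A \<rho> \<eta> Rd x (k * \<epsilon>)
        - S_star TYPE('e) * (R_bare A \<rho> \<eta> x * (k * \<epsilon>)^2 + Theta A \<rho> \<eta> x * (k * \<epsilon>)^3)\<bar> \<le> \<bar>C\<bar> * (k * \<epsilon>)^4"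
      if "k \<in> {1, 2, 3}" for k
    proof -
      have "0 < k * \<epsilon> \<and> k * \<epsilon> < \<epsilon>0" using that \<epsilon> by auto
      note expansion[rule_format, OF x this]
      also have "C * (k * \<epsilon>)^4 \<le> \<bar>C\<bar> * (k * \<epsilon>)^4" by (rule mult_right_mono) simp_all
      finally show ?thesis .
    qed
    show "\<bar>R_hat (S_star TYPE('e)) (bubble_energy A \<rho> \<eta> Rd x) \<epsilon> - R_bare A \<rho> \<eta> x\<bar> \<le> ?C * \<epsilon>^2"
      by (rule three_scale_estimators(1)[OF S conjunct1[OF \<epsilon>]]) (rule scales)
    have "\<bar>Theta_hat (S_star TYPE('e)) (bubble_energy A \<rho> \<eta> Rd x) \<epsilon> - Theta A \<rho> \<eta> x\<bar>
        \<le> 22 * \<bar>C\<bar> / S_star TYPE('e) * \<epsilon>"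
      by (rule three_scale_estimators(2)[OF S conjunct1[OF \<epsilon>]]) (rule scales)
    also have "\<dots> \<le> ?C * \<epsilon>"
      using S \<epsilon> by (intro mult_right_mono divide_right_mono) simp_all
    finally show "\<bar>Theta_hat (S_star TYPE('e)) (bubble_energy A \<rho> \<eta> Rd x) \<epsilon> - Theta A \<rho> \<eta> x\<bar> \<le> ?C * \<epsilon>" .
  qed
qed

end
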